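(* Let $I=[0,1]$ and let $\phi:I\to\mathbb{R}$ satisfy $\phi(0)=\phi(1)=0$ and $|\phi(x)-\phi(y)|\le|x-y|$ for all $x,y\in I$. For $\theta\in[-1,1]$ let $C_\theta(u,v)=uv+\theta\,\phi(u)\phi(v)$ and let $\sigma_\theta,\tau_\theta,\rho_\theta$ be the association coefficients of $C_\theta$. Then for all $\theta\in[-1,1]$, $$0\le\sigma_\theta\le \tfrac34|\theta|,\qquad |\tau_\theta|\le\tfrac12|\theta|,\qquad |\rho_\theta|\le\tfrac34|\theta| .$$
   Context: Under the stated conditions on $\phi$, $C_\theta$ is a bivariate copula (a bivariate distribution function on $I^2$ with uniform margins). For a copula $C$ the association coefficients are: the normalized volume $\sigma=12\int_0^1\int_0^1|C(u,v)-uv|\,du\,dv$; Kendall's Tau $\tau=4\int_0^1\int_0^1 C(u,v)\,dC(u,v)-1$, where $dC$ denotes integration with respect to the probability measure on $I^2$ with distribution function $C$; Spearman's Rho $\rho=12\int_0^1\int_0^1 C(u,v)\,du\,dv-3$. The coefficients for $C=C_\theta$ are denoted $\sigma_\theta,\tau_\theta,\rho_\theta$. *)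

theory Defs
  imports "HOL-Probability.Probability"
begin

text \<open>Functions \<open>C\<close> on the unit square are total functions \<open>real \<Rightarrow> real \<Rightarrow> real\<close>;
  only their values on \<open>{0..1} \<times> {0..1}\<close> are ever used.\<close>

definition has_distribution_on_square ::
    "(real \<times> real) measure \<Rightarrow> (real \<Rightarrow> real \<Rightarrow> real) \<Rightarrow> bool" where
  "has_distribution_on_square M C \<longleftrightarrow>
     prob_space M \<and>
     sets M = sets (restrict_space borel ({0..1} \<times> {0..1})) \<and>
     (\<forall>u\<in>{0..1}. \<forall>v\<in>{0..1}. measure M ({0..u} \<times> {0..v}) = C u v)"

text \<open>Such a measure is unique if it exists, since the rectangles \<open>{0..u} \<times> {0..v}\<close> form an
  intersection-stable generator of the Borel sets of the square. It exists whenever \<open>C\<close> is a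
  copula.\<close>

definition copula_measure :: "(real \<Rightarrow> real \<Rightarrow> real) \<Rightarrow> (real \<times> real) measure" where
  "copula_measure C = (THE M. has_distribution_on_square M C)"

definition normalized_volume :: "(real \<Rightarrow> real \<Rightarrow> real) \<Rightarrow> real" where
  "normalized_volume C = 12 * (LBINT v:{0..1}. LBINT u:{0..1}. \<bar>C u v - u * v\<bar>)"

definition kendall_tau :: "(real \<Rightarrow> real \<Rightarrow> real) \<Rightarrow> real" where
  "kendall_tau C = 4 * (LINT (u, v)|copula_measure C. C u v) - 1"

definition spearman_rho :: "(real \<Rightarrow> real \<Rightarrow> real) \<Rightarrow> real" where
  "spearman_rho C = 12 * (LBINT v:{0..1}. LBINT u:{0..1}. C u v) - 3"

definition copula_family :: "(real \<Rightarrow> real) \<Rightarrow> real \<Rightarrow> real \<Rightarrow> real \<Rightarrow> real" where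
  "copula_family \<phi> \<theta> u v = u * v + \<theta> * \<phi> u * \<phi> v"

end

(* Put p u = u + \<phi> u and q u = u - \<phi> u. The Lipschitz condition makes p and q distribution functions
   of atomless laws P and Q on [0,1], and substituting u = (p + q)/2, \<phi> = (p - q)/2 gives
     C u v = (1 + \<theta>)/4 * (p u * p v + q u * q v) + (1 - \<theta>)/4 * (p u * q v + q u * p v).
   So the measure of C is a mixture of the four products of P and Q, and no density of \<phi> is needed.
   Under the mixture, the integral of f u * g v is s f * s g + \<theta> * d f * d g, where s and d are half
   the sum and half the difference of the means under P and Q. With J the integral of \<phi>, integration
   by parts gives s id = 1/2, d id = - J, s \<phi> = J, d \<phi> = 0, hence \<tau> = 8 * \<theta> * J^2. Moreover
   \<rho> = 12 * \<theta> * J^2 and \<sigma> = 12 * \<bar>\<theta>\<bar> * K^2, where K is the integral of \<bar>\<phi>\<bar>. Finally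
   \<bar>\<phi> x\<bar> \<le> min x (1 - x) yields \<bar>J\<bar> \<le> K \<le> 1/4. *)

theory Submission
  imports Defs
begin

section \<open>Borel sets of the square and uniqueness of the copula measure\<close>

text \<open>Needed because products of laws on [0,1] carry the product sigma-algebra, whereas
  \<open>has_distribution_on_square\<close> prescribes the trace of the Borel sets of the plane.
  Measurable rectangles give one inclusion; measurability of the identity into \<open>borel\<close>
  gives the other.\<close>

lemma sets_restrict_space_pair_borel:
  fixes A :: "'a::second_countable_topology set" and B :: "'b::second_countable_topology set"
  assumes "A \<in> sets borel" "B \<in> sets borel"
  shows "sets (restrict_space borel A \<Otimes>\<^sub>M restrict_space borel B)
    = sets (restrict_space borel (A \<times> B))" (is "sets (?A \<Otimes>\<^sub>M ?B) = sets ?AB")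
proof -
  have AB: "A \<times> B \<in> sets borel"
    unfolding borel_prod[symmetric] using assms by simp
  have "sets (?A \<Otimes>\<^sub>M ?B) \<subseteq> sets ?AB"
  proof -
    have "a \<times> b \<in> sets ?AB" if "a \<in> sets ?A" "b \<in> sets ?B" for a b
    proof -
      have "a \<in> sets borel" "a \<subseteq> A" "b \<in> sets borel" "b \<subseteq> B"
        using that assms by (auto simp: sets_restrict_space_iff)
      then have "a \<times> b \<in> sets borel" "a \<times> b \<subseteq> A \<times> B"
        unfolding borel_prod[symmetric] by auto
      then show ?thesis
        using AB by (simp add: sets_restrict_space_iff)
    qed
    then have "sigma_sets (space ?AB) {a \<times> b |a b. a \<in> sets ?A \<and> b \<in> sets ?B} \<subseteq> sets ?AB"
      by (intro sets.sigma_sets_subset) auto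
    then show ?thesis
      by (simp add: sets_pair_measure space_restrict_space)
  qed
  moreover have "sets ?AB \<subseteq> sets (?A \<Otimes>\<^sub>M ?B)"
  proof -
    have id: "(\<lambda>x. x) \<in> ?A \<Otimes>\<^sub>M ?B \<rightarrow>\<^sub>M borel"
      unfolding borel_prod[symmetric]
      by (rule measurable_pair)
        (auto simp: comp_def intro!: measurable_restrict_space1
          measurable_compose[OF measurable_fst] measurable_compose[OF measurable_snd])
    show ?thesis
    proof
      fix S assume "S \<in> sets ?AB"
      then have S: "S \<in> sets borel" "S \<subseteq> A \<times> B"
        using AB by (auto simp: sets_restrict_space_iff)
      have "(\<lambda>x. x) -` S \<inter> space (?A \<Otimes>\<^sub>M ?B) \<in> sets (?A \<Otimes>\<^sub>M ?B)"
        using measurable_sets[OF id S(1)] .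
      moreover have "(\<lambda>x. x) -` S \<inter> space (?A \<Otimes>\<^sub>M ?B) = S"
        using S(2) by (auto simp: space_pair_measure space_restrict_space)
      ultimately show "S \<in> sets (?A \<Otimes>\<^sub>M ?B)" by simp
    qed
  qed
  ultimately show ?thesis by (rule antisym)
qed

text \<open>Both measures are pushed forward to the whole plane, where the quadrants
  \<open>{..a}\<close> are an intersection-stable generator whose masses are determined by
  \<open>C\<close>.\<close>

lemma has_distribution_on_square_unique:
  assumes "has_distribution_on_square M C" "has_distribution_on_square N C"
  shows "M = N"
proof -
  have square: "{0..1} \<times> {0..1} \<in> sets (borel :: (real \<times> real) measure)"
    unfolding borel_prod[symmetric] by simp
  let ?D = "\<lambda>M. distr M borel (\<lambda>x::real \<times> real. x)"
  have id: "(\<lambda>x. x) \<in> M \<rightarrow>\<^sub>M borel" if "has_distribution_on_square M C" for M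
  proof -
    have s: "sets M = sets (restrict_space borel ({0..1} \<times> {0..1}))"
      using that by (simp add: has_distribution_on_square_def)
    show ?thesis
      unfolding measurable_cong_sets[OF s refl] by (simp add: measurable_restrict_space1)
  qed
  have sp: "space M = {0..1} \<times> {0..1}" if "has_distribution_on_square M C" for M
    using that sets_eq_imp_space_eq[of M "restrict_space borel ({0..1} \<times> {0..1})"]
    by (simp add: has_distribution_on_square_def space_restrict_space)
  \<comment> \<open>A quadrant meets the square in a rectangle at the origin: coordinates of the
    corner beyond 1 are cut down to 1, and a negative coordinate leaves the empty set.\<close>
  have cdf: "emeasure (?D M) {..a}
      = (if 0 \<le> fst a \<and> 0 \<le> snd a then ennreal (C (min 1 (fst a)) (min 1 (snd a))) else 0)"
    if M: "has_distribution_on_square M C" for M a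
  proof -
    interpret prob_space M using M by (simp add: has_distribution_on_square_def)
    have "emeasure (?D M) {..a} = emeasure M ({..a} \<inter> ({0..1} \<times> {0..1}))"
      using id[OF M] by (simp add: emeasure_distr sp[OF M])
    also have "{..a} \<inter> ({0..1} \<times> {0..1}) = (if 0 \<le> fst a \<and> 0 \<le> snd a
        then {0..min 1 (fst a)} \<times> {0..min 1 (snd a)} else {})"
      by (auto simp: less_eq_prod_def)
    finally show ?thesis
      using M by (auto simp: has_distribution_on_square_def emeasure_eq_measure)
  qed
  have finite: "emeasure (?D M) A \<noteq> \<infinity>" if "has_distribution_on_square M C" for M A
  proof -
    interpret prob_space "?D M"
      using that id[OF that] by (intro prob_space.prob_space_distr)
        (auto simp: has_distribution_on_square_def)
    show ?thesis by simp
  qed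
  have eq: "?D M = ?D N"
  proof (rule measure_eqI_generator_eq[where A = "\<lambda>n. {..(real n, real n)}"])
    show "Int_stable (range (\<lambda>a::real \<times> real. {..a}))"
    proof (rule Int_stableI_image)
      fix a b :: "real \<times> real"
      have "{..a} \<inter> {..b} = {..(min (fst a) (fst b), min (snd a) (snd b))}"
        by (auto simp: less_eq_prod_def)
      then show "\<exists>c\<in>UNIV. {..a} \<inter> {..b} = {..c}" by blast
    qed
    show "emeasure (?D M) X = emeasure (?D N) X" if "X \<in> range (\<lambda>a. {..a})" for X
      using that by (auto simp: cdf[OF assms(1)] cdf[OF assms(2)])
    show "sets (?D M) = sigma_sets UNIV (range (\<lambda>a. {..a}))"
      "sets (?D N) = sigma_sets UNIV (range (\<lambda>a. {..a}))"
      by (simp_all add: borel_eq_atMost)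
    show "(\<Union>n. {..(real n, real n)}) = UNIV"
    proof safe
      fix x y :: real
      obtain n :: nat where "max x y \<le> real n" using real_arch_simple by blast
      then show "(x, y) \<in> (\<Union>n. {..(real n, real n)})" by auto
    qed auto
    show "emeasure (?D M) {..(real n, real n)} \<noteq> \<infinity>" for n
      by (rule finite[OF assms(1)])
  qed auto
  \<comment> \<open>Back to the square: its Borel subsets have the same mass before and after the
    pushforward.\<close>
  show ?thesis
  proof (rule measure_eqI)
    show "sets M = sets N"
      using assms by (simp add: has_distribution_on_square_def)
    fix A assume A: "A \<in> sets M"
    then have A': "A \<in> sets borel" "A \<subseteq> {0..1} \<times> {0..1}"
      using assms(1) square by (auto simp: has_distribution_on_square_def sets_restrict_space_iff)
    have "emeasure (?D M') A = emeasure M' A" if "has_distribution_on_square M' C" for M'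
      using A' by (simp add: emeasure_distr id that sp Int_absorb2)
    then show "emeasure M A = emeasure N A"
      using eq assms by metis
  qed
qed

text \<open>Uniqueness resolves the definite description, so it suffices to exhibit one measure with
  distribution function \<open>C\<close>.\<close>

lemma copula_measure_eq:
  assumes "has_distribution_on_square M C"
  shows "copula_measure C = M"
  unfolding copula_measure_def using assms has_distribution_on_square_unique by blast

section \<open>Laws on [0,1] with a continuous distribution function\<close>

text \<open>The case \<open>a = b\<close> makes \<open>M\<close> atomless.\<close>

definition unit_law :: "real measure \<Rightarrow> (real \<Rightarrow> real) \<Rightarrow> bool" where
  "unit_law M F \<longleftrightarrow> prob_space M \<and> sets M = sets (restrict_space borel {0..1})
    \<and> (\<forall>a b. 0 \<le> a \<and> a \<le> b \<and> b \<le> 1 \<longrightarrow> measure M {a..b} = F b - F a)"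

lemma space_unit_law:
  assumes "unit_law M F"
  shows "space M = {0..1}"
  using assms sets_eq_imp_space_eq[of M "restrict_space borel {0..1}"]
  by (simp add: unit_law_def space_restrict_space)

lemma measurable_unit_law:
  assumes "unit_law M F" "f \<in> borel_measurable borel"
  shows "f \<in> borel_measurable M"
proof -
  have s: "sets M = sets (restrict_space borel {0..1})"
    using assms by (simp add: unit_law_def)
  show ?thesis
    unfolding measurable_cong_sets[OF s refl] using assms(2) by (rule measurable_restrict_space1)
qed

lemma measurable_unit_law_continuous:
  fixes f :: "real \<Rightarrow> real"
  assumes "unit_law M F" "continuous_on {0..1} f"
  shows "f \<in> borel_measurable M"
proof -
  have s: "sets M = sets (restrict_space borel {0..1})"
    using assms by (simp add: unit_law_def)
  show ?thesis
    unfolding measurable_cong_sets[OF s refl]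
    using assms(2) by (rule borel_measurable_continuous_on_restrict)
qed

lemma continuous_on_unit_bounded:
  fixes f :: "real \<Rightarrow> real"
  assumes "continuous_on {0..1} f"
  obtains B where "\<And>x. x \<in> {0..1} \<Longrightarrow> \<bar>f x\<bar> \<le> B"
proof -
  have "bounded (f ` {0..1})"
    using assms by (intro compact_imp_bounded compact_continuous_image) auto
  then obtain B where "\<forall>y\<in>f ` {0..1}. norm y \<le> B" unfolding bounded_iff by blast
  then show ?thesis using that[of B] by auto
qed

lemma integrable_unit_law:
  fixes f :: "real \<Rightarrow> real"
  assumes M: "unit_law M F" and f: "continuous_on {0..1} f"
  shows "integrable M f"
proof -
  interpret prob_space M using M by (simp add: unit_law_def)
  obtain B where "\<And>x. x \<in> {0..1} \<Longrightarrow> \<bar>f x\<bar> \<le> B"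
    using continuous_on_unit_bounded[OF f] by blast
  then show ?thesis
    using measurable_unit_law_continuous[OF M f]
    by (intro integrable_const_bound[where B=B]) (auto simp: space_unit_law[OF M])
qed

text \<open>The Stieltjes measure of \<open>F\<close>, restricted to [0,1], has the required
  masses.\<close>

lemma unit_law_exists:
  fixes F :: "real \<Rightarrow> real"
  assumes cont: "continuous_on {0..1} F" and mono: "mono_on {0..1} F" and tot: "F 1 - F 0 = 1"
  shows "\<exists>M. unit_law M F"
proof -
  \<comment> \<open>Clipping the argument to [0,1] extends \<open>F\<close> by constants to a
    monotone continuous function on the line, as \<open>interval_measure\<close> expects.\<close>
  define G where "G x = F (max 0 (min 1 x))" for x
  have G_mono: "G x \<le> G y" if "x \<le> y" for x y
    unfolding G_def using that by (intro mono_onD[OF mono]) auto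
  have G_cont: "continuous_on UNIV G"
    unfolding G_def by (intro continuous_on_compose2[OF cont] continuous_intros) auto
  \<comment> \<open>Continuity of \<open>G\<close> leaves no mass at the left endpoint, so closed
    intervals have the same mass as half-open ones.\<close>
  have Icc: "emeasure (interval_measure G) {a..b} = F b - F a" if "0 \<le> a" "a \<le> b" "b \<le> 1" for a b
    using emeasure_interval_measure_Icc[OF that(2) G_mono G_cont] that by (simp add: G_def)
  let ?M = "restrict_space (interval_measure G) {0..1}"
  have "prob_space ?M"
    using Icc[of 0 1] tot by (intro prob_space_restrict_space) auto
  moreover have "sets ?M = sets (restrict_space borel {0..1})"
    by (intro sets_restrict_space_cong) simp
  moreover have "measure ?M {a..b} = F b - F a" if "0 \<le> a" "a \<le> b" "b \<le> 1" for a b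
  proof -
    have "F a \<le> F b" using that by (intro mono_onD[OF mono]) auto
    moreover have "emeasure ?M {a..b} = F b - F a"
      using that Icc[of a b] by (subst emeasure_restrict_space) auto
    ultimately show ?thesis by (simp add: measure_def)
  qed
  ultimately show ?thesis by (auto simp: unit_law_def)
qed

text \<open>The uniform law, through which Lebesgue integrals over [0,1] take part in the
  integration by parts below.\<close>

lemma unit_law_lborel: "unit_law (restrict_space lborel {0..1}) (\<lambda>x. x)"
  unfolding unit_law_def
proof (intro conjI allI impI)
  show "prob_space (restrict_space lborel {0..1::real})"
    by (intro prob_space_restrict_space) auto
  show "sets (restrict_space lborel {0..1::real}) = sets (restrict_space borel {0..1})"
    by (intro sets_restrict_space_cong) simp
  show "measure (restrict_space lborel {0..1}) {a..b} = b - a" if "0 \<le> a \<and> a \<le> b \<and> b \<le> 1" for a b :: real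
    using that by (subst measure_restrict_space) auto
qed

text \<open>Integration by parts: both sides are evaluations of \<open>M \<Otimes> N\<close> on \<open>{(x, y). x \<le> y}\<close>.\<close>

lemma integral_unit_law_swap:
  assumes M: "unit_law M F" and N: "unit_law N G"
    and G: "continuous_on {0..1} G" and F0: "F 0 = 0" and G1: "G 1 = 1"
  shows "(LINT y|N. F y) = 1 - (LINT x|M. G x)"
proof -
  interpret M: prob_space M using M by (simp add: unit_law_def)
  interpret N: prob_space N using N by (simp add: unit_law_def)
  interpret pair_prob_space M N ..
  let ?h = "\<lambda>x y. indicat_real {..y} x"
  have fst: "fst \<in> borel_measurable (M \<Otimes>\<^sub>M N)"
    using measurable_unit_law[OF M, of "\<lambda>x. x"] measurable_compose[OF measurable_fst] by auto
  have snd: "snd \<in> borel_measurable (M \<Otimes>\<^sub>M N)"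
    using measurable_unit_law[OF N, of "\<lambda>x. x"] measurable_compose[OF measurable_snd] by auto
  have eq: "case_prod ?h = indicator {z. fst z \<le> snd z}"
    by (auto simp: indicator_def fun_eq_iff)
  have "{z \<in> space (M \<Otimes>\<^sub>M N). fst z \<le> snd z} \<in> sets (M \<Otimes>\<^sub>M N)"
    using fst snd by measurable
  then have int: "integrable (M \<Otimes>\<^sub>M N) (case_prod ?h)"
    unfolding eq by (intro P.integrable_const_bound[where B=1])
      (auto simp: borel_measurable_indicator_iff Int_def conj_commute)
  have "(LINT x|M. ?h x y) = F y" if "y \<in> space N" for y
  proof -
    have "{..y} \<inter> space M = {0..y}"
      using that by (auto simp: space_unit_law[OF M] space_unit_law[OF N])
    then show ?thesis
      using M that F0 by (auto simp: unit_law_def space_unit_law[OF N])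
  qed
  then have "(LINT y|N. F y) = (LINT y|N. (LINT x|M. ?h x y))"
    by (intro Bochner_Integration.integral_cong) auto
  also have "\<dots> = (LINT x|M. (LINT y|N. ?h x y))"
    by (rule Fubini_integral[OF int])
  \<comment> \<open>The slice over \<open>x\<close> is the closed interval \<open>{x..1}\<close>. It
    contains \<open>x\<close> itself, yet its mass is exactly \<open>1 - G x\<close> because
    \<open>N\<close> has no atoms.\<close>
  also have "\<dots> = (LINT x|M. 1 - G x)"
  proof (intro Bochner_Integration.integral_cong refl)
    fix x assume x: "x \<in> space M"
    have "?h x y = indicator {x..} y" for y by (auto simp: indicator_def)
    moreover have "{x..} \<inter> space N = {x..1}"
      using x by (auto simp: space_unit_law[OF M] space_unit_law[OF N])
    ultimately show "(LINT y|N. ?h x y) = 1 - G x"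
      using N x G1 by (auto simp: unit_law_def space_unit_law[OF M])
  qed
  also have "\<dots> = 1 - (LINT x|M. G x)"
    using integrable_unit_law[OF M G] by (simp add: M.prob_space)
  finally show ?thesis .
qed


section \<open>Mixtures of product laws\<close>

lemma unit_law_pair_mult:
  assumes M: "unit_law M F" and N: "unit_law N G"
    and f: "f \<in> borel_measurable (restrict_space borel {0..1})" "\<And>x. x \<in> {0..1} \<Longrightarrow> \<bar>f x\<bar> \<le> B"
    and g: "g \<in> borel_measurable (restrict_space borel {0..1})" "\<And>x. x \<in> {0..1} \<Longrightarrow> \<bar>g x\<bar> \<le> B"
  shows "(LINT (u, v)|(M \<Otimes>\<^sub>M N). f u * g v) = (LINT u|M. f u) * (LINT v|N. g v :: real)"
proof -
  interpret M: prob_space M using M by (simp add: unit_law_def)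
  interpret N: prob_space N using N by (simp add: unit_law_def)
  interpret pair_prob_space M N ..
  have sets: "sets M = sets (restrict_space borel {0..1})" "sets N = sets (restrict_space borel {0..1})"
    using M N by (auto simp: unit_law_def)
  have [measurable]: "f \<in> borel_measurable M" "g \<in> borel_measurable N"
    using f g by (simp_all add: measurable_cong_sets[OF sets(1) refl] measurable_cong_sets[OF sets(2) refl])
  have int: "integrable (M \<Otimes>\<^sub>M N) (\<lambda>(u, v). f u * g v)"
  proof (rule P.integrable_const_bound[where B="B * B"])
    have "0 \<le> B" using f(2)[of 0] by simp
    then show "AE z in M \<Otimes>\<^sub>M N. norm (case z of (u, v) \<Rightarrow> f u * g v) \<le> B * B"
      using f(2) g(2)
      by (intro AE_I2) (auto simp: space_pair_measure space_unit_law[OF M] space_unit_law[OF N] abs_mult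
        intro!: mult_mono)
  qed simp
  have "(LINT (u, v)|(M \<Otimes>\<^sub>M N). f u * g v) = (LINT u|M. (LINT v|N. f u * g v))"
    using integral_fst[OF int] by simp
  also have "\<dots> = (LINT u|M. f u) * (LINT v|N. g v)"
    by simp
  finally show ?thesis .
qed

text \<open>The mixture gives weight \<open>(1 + \<theta>) / 4\<close> to each of
  \<open>P \<Otimes>\<^sub>M P\<close> and \<open>Q \<Otimes>\<^sub>M Q\<close>, and
  \<open>(1 - \<theta>) / 4\<close> to each mixed product. Test functions are bounded measurable
  rather than continuous, so that indicators of intervals can be inserted to read off the
  distribution function.\<close>

lemma unit_law_mixture_exists:
  fixes \<theta> :: real
  assumes P: "unit_law P F" and Q: "unit_law Q G" and \<theta>: "\<theta> \<in> {-1..1}"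
  obtains M where "prob_space M" "sets M = sets (restrict_space borel ({0..1} \<times> {0..1}))"
    "\<And>f g B. f \<in> borel_measurable (restrict_space borel {0..1}) \<Longrightarrow>
      g \<in> borel_measurable (restrict_space borel {0..1}) \<Longrightarrow>
      (\<And>x. x \<in> {0..1} \<Longrightarrow> \<bar>f x\<bar> \<le> B) \<Longrightarrow> (\<And>x. x \<in> {0..1} \<Longrightarrow> \<bar>g x\<bar> \<le> B) \<Longrightarrow>
      (LINT (u, v)|M. f u * g v) =
        ((LINT x|P. f x) + (LINT x|Q. f x)) / 2 * (((LINT x|P. g x) + (LINT x|Q. g x)) / 2)
        + \<theta> * (((LINT x|P. f x) - (LINT x|Q. f x)) / 2 * (((LINT x|P. g x) - (LINT x|Q. g x)) / 2))"
proof
  define m where "m i = (if i then P else Q)" for i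
  define H where "H i = (if i then F else G)" for i
  have m: "unit_law (m i) (H i)" for i
    using P Q by (simp add: m_def H_def)
  let ?R = "restrict_space borel {0..1::real}"
  \<comment> \<open>The fair coin \<open>i\<close> selects the law of the first coordinate;
    \<open>k\<close>, true with probability \<open>(1 + \<theta>) / 2\<close>, says whether the
    second coordinate has the same law.\<close>
  let ?K = "\<lambda>(i, k). m i \<Otimes>\<^sub>M m (i = k)"
  define W where "W = pair_pmf (bernoulli_pmf (1/2)) (bernoulli_pmf ((1 + \<theta>) / 2))"
  define M where "M = measure_pmf W \<bind> ?K"
  have "m i \<in> space (prob_algebra ?R)" for i
    using m[of i] by (auto simp: space_prob_algebra unit_law_def)
  then have K: "?K \<in> measure_pmf W \<rightarrow>\<^sub>M prob_algebra (?R \<Otimes>\<^sub>M ?R)"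
    by (auto simp: space_prob_algebra intro!: prob_space_pair sets_pair_measure_cong)
  have W: "measure_pmf W \<in> space (prob_algebra (measure_pmf W))"
    by (simp add: space_prob_algebra prob_space_measure_pmf)
  show "prob_space M"
    unfolding M_def by (rule prob_space_bind'[OF W K])
  have sets: "sets M = sets (?R \<Otimes>\<^sub>M ?R)"
    unfolding M_def by (rule sets_bind'[OF W K])
  then show "sets M = sets (restrict_space borel ({0..1} \<times> {0..1}))"
    by (simp add: sets_restrict_space_pair_borel)
  fix f g :: "real \<Rightarrow> real" and B
  assume f: "f \<in> borel_measurable ?R" "\<And>x. x \<in> {0..1} \<Longrightarrow> \<bar>f x\<bar> \<le> B"
    and g: "g \<in> borel_measurable ?R" "\<And>x. x \<in> {0..1} \<Longrightarrow> \<bar>g x\<bar> \<le> B"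
  have [measurable]: "f \<in> borel_measurable ?R" "g \<in> borel_measurable ?R"
    by fact+
  have B0: "0 \<le> B" using f(2)[of 0] by simp
  have "(LINT (u, v)|M. f u * g v) = (LINT i|(measure_pmf W). (LINT (u, v)|(?K i). f u * g v))"
    unfolding M_def
  proof (rule integral_bind[where K = "?R \<Otimes>\<^sub>M ?R" and B = "B * B" and B' = 1])
    show "(\<lambda>(u, v). f u * g v) \<in> borel_measurable (?R \<Otimes>\<^sub>M ?R)" by simp
    show "?K \<in> measure_pmf W \<rightarrow>\<^sub>M subprob_algebra (?R \<Otimes>\<^sub>M ?R)"
      by (rule measurable_prob_algebraD[OF K])
    show "finite_measure (measure_pmf W)" by unfold_locales simp
    show "\<bar>case z of (u, v) \<Rightarrow> f u * g v\<bar> \<le> B * B" if "z \<in> space (?R \<Otimes>\<^sub>M ?R)" for z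
      using that f(2) g(2) B0
      by (auto simp: space_pair_measure space_restrict_space abs_mult intro!: mult_mono)
    have "prob_space (?K i)" for i
      using m by (auto simp: unit_law_def split_beta intro!: prob_space_pair)
    then show "AE i in measure_pmf W. emeasure (?K i) (space (?K i)) \<le> ennreal 1"
      by (intro AE_I2) (simp add: prob_space.emeasure_space_1)
  qed
  also have "\<dots> = (LINT (i, k)|(measure_pmf W). (LINT x|(m i). f x) * (LINT x|(m (i = k)). g x))"
    using unit_law_pair_mult[OF m m f(1) f(2) g(1) g(2)]
    by (intro Bochner_Integration.integral_cong) auto
  also have "\<dots> = (\<Sum>(i, k)\<in>UNIV. (LINT x|(m i). f x) * (LINT x|(m (i = k)). g x) * pmf W (i, k))"
    by (subst integral_measure_pmf_real[of UNIV]) (auto simp: split_beta)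
  \<comment> \<open>The range of \<open>\<theta>\<close> makes \<open>(1 + \<theta>) / 2\<close> a
    genuine probability; regrouping the four weighted products by half sums and half differences
    gives the formula.\<close>
  also have "\<dots> = ((LINT x|P. f x) + (LINT x|Q. f x)) / 2 * (((LINT x|P. g x) + (LINT x|Q. g x)) / 2)
        + \<theta> * (((LINT x|P. f x) - (LINT x|Q. f x)) / 2 * (((LINT x|P. g x) - (LINT x|Q. g x)) / 2))"
    using \<theta> unfolding UNIV_Times_UNIV[symmetric] sum.cartesian_product[symmetric]
    by (simp add: W_def pmf_pair UNIV_bool m_def field_simps)
  finally show "(LINT (u, v)|M. f u * g v) =
        ((LINT x|P. f x) + (LINT x|Q. f x)) / 2 * (((LINT x|P. g x) + (LINT x|Q. g x)) / 2)
        + \<theta> * (((LINT x|P. f x) - (LINT x|Q. f x)) / 2 * (((LINT x|P. g x) - (LINT x|Q. g x)) / 2))" .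
qed

section \<open>Kendall's tau of the family\<close>

locale copula_perturbation =
  fixes \<phi> :: "real \<Rightarrow> real"
  assumes \<phi>0: "\<phi> 0 = 0" and \<phi>1: "\<phi> 1 = 0"
    and lipschitz: "x \<in> {0..1} \<Longrightarrow> y \<in> {0..1} \<Longrightarrow> \<bar>\<phi> x - \<phi> y\<bar> \<le> \<bar>x - y\<bar>"
begin

lemma continuous: "continuous_on {0..1} \<phi>"
  by (rule lipschitz_on_continuous_on[of 1]) (auto intro!: lipschitz_onI lipschitz simp: dist_real_def)

abbreviation "U \<equiv> restrict_space lborel {0..1::real}"

text \<open>Once the mixture is identified as the copula measure, the integrand is a combination of
  the products \<open>u * v\<close> and \<open>\<phi> u * \<phi> v\<close>, so only the means of the
  identity and of \<open>\<phi>\<close> under \<open>P\<close> and \<open>Q\<close> enter.\<close>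

lemma kendall_tau_copula_family:
  assumes \<theta>: "\<theta> \<in> {-1..1}"
  shows "kendall_tau (copula_family \<phi> \<theta>) = 8 * \<theta> * (LINT x|U. \<phi> x)\<^sup>2"
proof -
  define J where "J = (LINT x|U. \<phi> x)"
  let ?p = "\<lambda>x. x + \<phi> x" and ?q = "\<lambda>x. x - \<phi> x"
  have pc: "continuous_on {0..1} ?p" and qc: "continuous_on {0..1} ?q"
    by (intro continuous_intros continuous)+
  \<comment> \<open>By the Lipschitz bound, \<open>\<phi>\<close> never rises or falls faster than
    the identity rises.\<close>
  have mono: "mono_on {0..1} ?p" "mono_on {0..1} ?q"
    using lipschitz by (fastforce intro!: mono_onI)+
  obtain P Q where P: "unit_law P ?p" and Q: "unit_law Q ?q"
    using unit_law_exists[OF pc mono(1)] unit_law_exists[OF qc mono(2)] \<phi>0 \<phi>1 by auto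
  interpret P: prob_space P using P by (simp add: unit_law_def)
  interpret Q: prob_space Q using Q by (simp add: unit_law_def)
  have id: "continuous_on {0..1::real} (\<lambda>x. x)" by (rule continuous_on_id)
  note int = integrable_unit_law[OF _ id] integrable_unit_law[OF _ continuous]
  \<comment> \<open>Swapping the uniform law with itself says that its mean \<open>m\<close>
    satisfies \<open>m = 1 - m\<close>.\<close>
  have U: "(LINT x|U. x) = 1 / 2"
    using integral_unit_law_swap[OF unit_law_lborel unit_law_lborel id] by simp
  \<comment> \<open>The mean under \<open>P\<close> is 1 minus the Lebesgue integral of its
    distribution function, that is \<open>1 - (1/2 + J)\<close>.\<close>
  have Px: "(LINT x|P. x) = 1 / 2 - J"
    using integral_unit_law_swap[OF unit_law_lborel P pc] U
      integral_unit_law_swap[OF P unit_law_lborel id] \<phi>0 \<phi>1 int[OF unit_law_lborel] by (simp add: J_def)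
  have Qx: "(LINT x|Q. x) = 1 / 2 + J"
    using integral_unit_law_swap[OF Q unit_law_lborel id] U \<phi>0 \<phi>1 int[OF unit_law_lborel]
    by (simp add: J_def)
  \<comment> \<open>Swapping \<open>P\<close> with itself shows that its distribution function
    \<open>x + \<phi> x\<close> has mean 1/2 under \<open>P\<close>; subtracting the mean of
    \<open>x\<close> leaves \<open>J\<close>. For \<open>Q\<close> the sign of \<open>\<phi>\<close>
    and that of the shift of the mean both flip, which gives \<open>J\<close> again.\<close>
  have P\<phi>: "(LINT x|P. \<phi> x) = J"
    using integral_unit_law_swap[OF P P pc] Px \<phi>0 \<phi>1 int[OF P] by simp
  have Q\<phi>: "(LINT x|Q. \<phi> x) = J"
    using integral_unit_law_swap[OF Q Q qc] Qx \<phi>0 \<phi>1 int[OF Q] by simp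
  obtain M where M: "prob_space M" "sets M = sets (restrict_space borel ({0..1} \<times> {0..1}))"
    and mix: "\<And>f g B. f \<in> borel_measurable (restrict_space borel {0..1}) \<Longrightarrow>
      g \<in> borel_measurable (restrict_space borel {0..1}) \<Longrightarrow>
      (\<And>x. x \<in> {0..1} \<Longrightarrow> \<bar>f x\<bar> \<le> B) \<Longrightarrow> (\<And>x. x \<in> {0..1} \<Longrightarrow> \<bar>g x\<bar> \<le> B) \<Longrightarrow>
      (LINT (u, v)|M. f u * g v) =
        ((LINT x|P. f x) + (LINT x|Q. f x)) / 2 * (((LINT x|P. g x) + (LINT x|Q. g x)) / 2)
        + \<theta> * (((LINT x|P. f x) - (LINT x|Q. f x)) / 2 * (((LINT x|P. g x) - (LINT x|Q. g x)) / 2))"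
    using unit_law_mixture_exists[OF P Q \<theta>] by metis
  interpret M: prob_space M by (rule M)
  have space_M: "space M = {0..1} \<times> {0..1}"
    using sets_eq_imp_space_eq[OF M(2)] by (simp add: space_restrict_space)
  \<comment> \<open>For indicators of \<open>{0..u}\<close> and \<open>{0..v}\<close>, the half sums
    are \<open>u\<close> and \<open>v\<close> and the half differences are \<open>\<phi> u\<close>
    and \<open>\<phi> v\<close>.\<close>
  have cdf: "measure M ({0..u} \<times> {0..v}) = copula_family \<phi> \<theta> u v"
    if u: "u \<in> {0..1}" and v: "v \<in> {0..1}" for u v
  proof -
    have ind: "(LINT x|P. indicat_real {0..w} x) = w + \<phi> w"
      "(LINT x|Q. indicat_real {0..w} x) = w - \<phi> w" if "w \<in> {0..1}" for w
    proof -
      have "{0..w} \<inter> {0..1} = {0..w}" using that by auto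
      then show "(LINT x|P. indicat_real {0..w} x) = w + \<phi> w"
        "(LINT x|Q. indicat_real {0..w} x) = w - \<phi> w"
        using P Q that \<phi>0 by (auto simp: space_unit_law[OF P] space_unit_law[OF Q])
          (auto simp: unit_law_def)
    qed
    have "({0..u} \<times> {0..v}) \<inter> space M = {0..u} \<times> {0..v}"
      using u v by (auto simp: space_M)
    then have "measure M ({0..u} \<times> {0..v}) = (LINT z|M. indicator ({0..u} \<times> {0..v}) z)"
      by simp
    also have "\<dots> = (LINT (x, y)|M. indicator {0..u} x * indicator {0..v} y)"
      by (intro Bochner_Integration.integral_cong) (auto simp: indicator_times)
    also have "\<dots> = copula_family \<phi> \<theta> u v"
      by (subst mix[of "indicator {0..u}" "indicator {0..v}" 1, unfolded ind[OF u] ind[OF v]])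
        (auto simp: copula_family_def indicator_le_1 intro!: measurable_restrict_space1)
    finally show ?thesis .
  qed
  have C: "copula_measure (copula_family \<phi> \<theta>) = M"
    by (rule copula_measure_eq) (simp add: has_distribution_on_square_def M cdf)
  have meas: "(\<lambda>x. x) \<in> borel_measurable (restrict_space borel {0..1::real})"
    "\<phi> \<in> borel_measurable (restrict_space borel {0..1})"
    by (intro borel_measurable_continuous_on_restrict id continuous)+
  have \<phi>_le: "\<bar>\<phi> x\<bar> \<le> 1" if "x \<in> {0..1}" for x
    using lipschitz[of x 0] that \<phi>0 by auto
  have int_M: "integrable M (\<lambda>(u, v). f u * f v)"
    if "f \<in> borel_measurable (restrict_space borel {0..1})" "\<And>x. x \<in> {0..1} \<Longrightarrow> \<bar>f x\<bar> \<le> 1"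
    for f :: "real \<Rightarrow> real"
  proof (rule M.integrable_const_bound[where B=1])
    have [measurable]: "f \<in> borel_measurable (restrict_space borel {0..1})" by fact
    show "(\<lambda>(u, v). f u * f v) \<in> borel_measurable M"
      \<comment> \<open>Measurability of the product is checked on the product sigma-algebra, which
        coincides with that of \<open>M\<close>.\<close>
      unfolding measurable_cong_sets[OF M(2) refl]
      unfolding sets_restrict_space_pair_borel[symmetric, OF atLeastAtMost_borel atLeastAtMost_borel,
        THEN measurable_cong_sets, OF refl] by simp
    show "AE z in M. norm (case z of (u, v) \<Rightarrow> f u * f v) \<le> 1"
      using that(2) by (intro AE_I2) (auto simp: space_M abs_mult intro!: mult_le_one)
  qed
  have "(LINT (u, v)|M. copula_family \<phi> \<theta> u v)
      = (LINT z|M. (\<lambda>(u, v). u * v) z + \<theta> * (\<lambda>(u, v). \<phi> u * \<phi> v) z)"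
    by (intro Bochner_Integration.integral_cong) (auto simp: copula_family_def)
  also have "\<dots> = (LINT (u, v)|M. u * v) + \<theta> * (LINT (u, v)|M. \<phi> u * \<phi> v)"
    using int_M[OF meas(1)] int_M[OF meas(2) \<phi>_le] by simp
  \<comment> \<open>The half difference of the means is \<open>- J\<close>, whose square carries the
    factor \<open>\<theta>\<close>; for \<open>\<phi>\<close> below it vanishes and only the half
    sum \<open>J\<close> remains. The total is
    \<open>1 / 4 + 2 * \<theta> * J\<^sup>2\<close>.\<close>
  also have "(LINT (u, v)|M. u * v) = 1 / 4 + \<theta> * J\<^sup>2"
    using mix[OF meas(1,1), of 1] by (simp add: Px Qx power2_eq_square)
  also have "(LINT (u, v)|M. \<phi> u * \<phi> v) = J\<^sup>2"
    using mix[OF meas(2,2) \<phi>_le \<phi>_le] by (simp add: P\<phi> Q\<phi> power2_eq_square)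
  finally show ?thesis
    by (simp add: kendall_tau_def C J_def)
qed

section \<open>The volume, Spearman's rho and the integral of the absolute value\<close>

lemma LBINT_unit: "(LBINT x:{0..1}. f x) = (LINT x|U. f x)" for f :: "real \<Rightarrow> real"
  by (simp add: set_lebesgue_integral_def integral_restrict_space)

text \<open>Comparing \<open>\<phi>\<close> with its zeros at 0 and 1 puts its absolute value below
  the tent function, a triangle of base 1 and height 1/2.\<close>

lemma integral_abs_le: "(LINT x|U. \<bar>\<phi> x\<bar>) \<le> 1 / 4"
proof -
  have "(LINT x|U. \<bar>\<phi> x\<bar>) \<le> (LINT x|U. min x (1 - x))"
  proof (rule integral_mono)
    show "integrable U (\<lambda>x. \<bar>\<phi> x\<bar>)" "integrable U (\<lambda>x. min x (1 - x))"
      by (intro integrable_unit_law[OF unit_law_lborel] continuous_intros continuous)+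
    show "\<bar>\<phi> x\<bar> \<le> min x (1 - x)" if "x \<in> space U" for x
      using that lipschitz[of x 0] lipschitz[of x 1] by (auto simp: \<phi>0 \<phi>1 space_restrict_space)
  qed
  also have "(LINT x|U. min x (1 - x)) = integral {0..1} (\<lambda>x. min x (1 - x))"
    unfolding LBINT_unit[symmetric]
    by (intro set_borel_integral_eq_integral(2) borel_integrable_atLeastAtMost') (intro continuous_intros)
  also have "\<dots> = 1 / 4"
  proof (rule integral_unique)
    \<comment> \<open>The integral is split at the peak 1/2, where the minimum changes
      branch.\<close>
    have 1: "((\<lambda>x::real. min x (1 - x)) has_integral ((1/2)\<^sup>2 / 2 - 0\<^sup>2 / 2)) {0..1/2}"
      by (rule has_integral_eq[OF _ fundamental_theorem_of_calculus[where f="\<lambda>x. x\<^sup>2 / 2"]])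
        (auto intro!: derivative_eq_intros simp: has_real_derivative_iff_has_vector_derivative[symmetric])
    have 2: "((\<lambda>x::real. min x (1 - x)) has_integral
        ((1 - 1\<^sup>2 / 2) - (1/2 - (1/2)\<^sup>2 / 2))) {1/2..1}"
      by (rule has_integral_eq[OF _ fundamental_theorem_of_calculus[where f="\<lambda>x. x - x\<^sup>2 / 2"]])
        (auto intro!: derivative_eq_intros simp: has_real_derivative_iff_has_vector_derivative[symmetric])
    show "((\<lambda>x::real. min x (1 - x)) has_integral (1 / 4)) {0..1}"
      using has_integral_combine[OF _ _ 1 2] by (simp add: power2_eq_square)
  qed
  finally show ?thesis .
qed

text \<open>The term \<open>u * v\<close> cancels, and the absolute value of the remaining product
  factorizes under the iterated integral.\<close>

lemma normalized_volume_copula_family: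
  "normalized_volume (copula_family \<phi> \<theta>) = 12 * \<bar>\<theta>\<bar> * (LINT x|U. \<bar>\<phi> x\<bar>)\<^sup>2"
  unfolding normalized_volume_def LBINT_unit copula_family_def
  by (simp add: abs_mult power2_eq_square)

text \<open>The term \<open>u * v\<close> integrates to 1/4, which cancels the constant 3; the
  perturbation factorizes.\<close>

lemma spearman_rho_copula_family:
  "spearman_rho (copula_family \<phi> \<theta>) = 12 * \<theta> * (LINT x|U. \<phi> x)\<^sup>2"
proof -
  have id: "continuous_on {0..1::real} (\<lambda>x. x)" by (rule continuous_on_id)
  have U: "(LINT x|U. x) = 1 / 2"
    using integral_unit_law_swap[OF unit_law_lborel unit_law_lborel id] by simp
  show ?thesis
    unfolding spearman_rho_def LBINT_unit copula_family_def
    using integrable_unit_law[OF unit_law_lborel id] integrable_unit_law[OF unit_law_lborel continuous]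
    by (simp add: U power2_eq_square)
qed

end

section \<open>Bounds for the three coefficients\<close>

theorem proposition2:
  fixes \<phi> :: "real \<Rightarrow> real" and \<theta> :: real
  assumes "\<phi> 0 = 0" and "\<phi> 1 = 0"
    and "\<And>x y. x \<in> {0..1} \<Longrightarrow> y \<in> {0..1} \<Longrightarrow> \<bar>\<phi> x - \<phi> y\<bar> \<le> \<bar>x - y\<bar>"
    and "\<theta> \<in> {-1..1}"
  shows "0 \<le> normalized_volume (copula_family \<phi> \<theta>)
    \<and> normalized_volume (copula_family \<phi> \<theta>) \<le> 3 / 4 * \<bar>\<theta>\<bar>
    \<and> \<bar>kendall_tau (copula_family \<phi> \<theta>)\<bar> \<le> 1 / 2 * \<bar>\<theta>\<bar>
    \<and> \<bar>spearman_rho (copula_family \<phi> \<theta>)\<bar> \<le> 3 / 4 * \<bar>\<theta>\<bar>"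
proof -
  interpret copula_perturbation \<phi>
    using assms by unfold_locales
  let ?J = "LINT x|U. \<phi> x" and ?K = "LINT x|U. \<bar>\<phi> x\<bar>"
  have K0: "0 \<le> ?K" by simp
  have JK: "\<bar>?J\<bar> \<le> ?K" by (rule integral_abs_bound)
  have "?K\<^sup>2 \<le> (1 / 4)\<^sup>2"
    using K0 integral_abs_le by (intro power_mono)
  moreover have "?J\<^sup>2 \<le> ?K\<^sup>2"
    using JK by (simp add: abs_le_square_iff[symmetric])
  \<comment> \<open>With squares at most 1/16, the factors 12 and 8 become the constants 3/4 and
    1/2.\<close>
  ultimately have K: "?K\<^sup>2 \<le> 1 / 16" and J: "?J\<^sup>2 \<le> 1 / 16"
    by (simp_all add: power2_eq_square)
  show ?thesis
    using mult_left_mono[OF K, of "\<bar>\<theta>\<bar>"] mult_left_mono[OF J, of "\<bar>\<theta>\<bar>"]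
    unfolding normalized_volume_copula_family spearman_rho_copula_family
      kendall_tau_copula_family[OF assms(4)]
    by (simp add: abs_mult)
qed

end
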